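(* Let $D=(d_1,d_2,\ldots,d_n)$ be a non-negative and non-increasing integer sequence. Then $D$ is a forcibly bicyclic graphic sequence if and only if one of the following holds: (1) $D=(3^2,2^4)$, or $D=(3^3,2^2,1)$, or $D=(3^3,2^3,1)$, or $D=(4,2^6)$, or $D=(4,3,2^4,1)$, or $D=(5,2^6,1)$; (2) $D=(n-1,2^4,1^{n-5})$, where $n\ge 5$; (3) $D=(n-2,2^5,1^{n-6})$, where $n\ge 6$; (4) $D=(n-2,3,2^3,1^{n-5})$, where $n\ge 5$; (5) $D=(r,s,t,2,1^{n-4})$, where $n\ge 4$, $r\ge s\ge 3$, $t\ge 2$ and $r+s+t=n+4$.
   Context: All graphs are finite and simple. A sequence $D=(d_1,\ldots,d_n)$ of non-negative integers is graphic if there is a simple graph with vertices $v_1,\ldots,v_n$ with $\deg(v_i)=d_i$ for all $i$; such a graph is a realization of $D$. A graphic sequence $D$ is forcibly $\mathcal{P}$ graphic if every realization of $D$ has property $\mathcal{P}$. A graph of order $n$ is bicyclic if it is connected and has exactly $n+1$ edges. The notation $(a_1^{c_1},\ldots,a_k^{c_k})$ means the sequence in which $a_i$ appears $c_i$ times (exponent $0$ means the term is absent). *)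

theory Defs
  imports "Graph_Theory.Digraph_Component"
begin

text \<open>
  A finite simple graph is a value satisfying \<open>pair_graph\<close>: a finite, loop-free, symmetric
  digraph whose arcs are ordered pairs. An undirected edge \<open>uv\<close> is thus represented by the two
  arcs \<open>(u, v)\<close> and \<open>(v, u)\<close>, so the degree of a vertex is its out-degree, while edges must be
  counted as unordered pairs.
\<close>

definition undirected_edges :: "'a pair_pre_digraph \<Rightarrow> 'a set set" where
  "undirected_edges G = {{u, v} | u v. (u, v) \<in> parcs G}"

definition bicyclic :: "'a pair_pre_digraph \<Rightarrow> bool" where
  "bicyclic G \<longleftrightarrow> pair_graph G \<and> Digraph_Component.connected (with_proj G) \<and>
     card (undirected_edges G) = card (pverts G) + 1"

text \<open>
  The vertices \<open>v\<^sub>1, \<dots>, v\<^sub>n\<close> of a realization are labelled \<open>0, \<dots>, n - 1\<close>; all graph properties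
  considered are invariant under relabelling.
\<close>

definition realization :: "nat list \<Rightarrow> nat pair_pre_digraph \<Rightarrow> bool" where
  "realization D G \<longleftrightarrow> pair_graph G \<and> pverts G = {..<length D} \<and>
     (\<forall>i < length D. out_degree (with_proj G) i = D ! i)"

definition graphic :: "nat list \<Rightarrow> bool" where
  "graphic D \<longleftrightarrow> (\<exists>G. realization D G)"

definition forcibly_graphic :: "(nat pair_pre_digraph \<Rightarrow> bool) \<Rightarrow> nat list \<Rightarrow> bool" where
  "forcibly_graphic P D \<longleftrightarrow> graphic D \<and> (\<forall>G. realization D G \<longrightarrow> P G)"

end

theory Submission
  imports Defs "HOL-Combinatorics.List_Permutation"
begin

text \<open>
  A sequence \<open>D\<close> of length \<open>n\<close> is forcibly bicyclic iff it is graphic, has sum \<open>2n + 2\<close>, and no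
  realization is disconnected. Write \<open>D = b @ 1\<^sup>p\<close> with \<open>k\<close> entries \<open>\<ge> 2\<close> in \<open>b\<close>. Counting arcs
  among the \<open>k\<close> big vertices shows that they span at least \<open>k + 1\<close> edges, so \<open>k \<ge> 4\<close>; the same count
  shows that every realization of \<open>(r, s, t, 2, 1\<^sup>p)\<close> is connected.

  If \<open>p \<ge> 2\<close>, a disconnected realization with a component \<open>K\<^sub>2\<close> exists as soon as some graph on the
  big vertices has \<open>k + 2\<close> edges and degrees bounded by \<open>b\<close>, since the missing degrees are filled
  up by pendant vertices. The degree excess over 2 of such a graph is one of the partitions
  \<open>6-2\<close>, \<open>(5-2) + (3-2)\<close>, \<open>(4-2) + (4-2)\<close>, \<open>(4-2) + 2(3-2)\<close>, \<open>4(3-2)\<close> of 4, and it exists iff \<open>k\<close>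
  is at least 7, 6, 5, 5, 4, respectively. If \<open>p \<le> 1\<close>, one splits off a triangle instead of \<open>K\<^sub>2\<close>.
\<close>

section \<open>Adjacency relations, separating sets, and the reduction of forcible bicyclicity to
  them\<close>

definition edge_realization :: "nat list \<Rightarrow> nat rel \<Rightarrow> bool" where
  "edge_realization D E \<longleftrightarrow> E \<subseteq> {..<length D} \<times> {..<length D} \<and> sym E \<and> irrefl E \<and>
     (\<forall>i < length D. card (E `` {i}) = D ! i)"

definition realizable :: "nat list \<Rightarrow> bool" where
  "realizable D \<longleftrightarrow> (\<exists>E. edge_realization D E)"

text \<open>For a symmetric \<open>E\<close>, such an \<open>S\<close> is a nonempty proper union of
  components. Disconnectedness thus becomes the existence of a set, and no paths have to be
  handled.\<close>

definition separates :: "nat \<Rightarrow> nat rel \<Rightarrow> nat set \<Rightarrow> bool" where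
  "separates n E S \<longleftrightarrow> S \<noteq> {} \<and> S \<subset> {..<n} \<and> E `` S \<subseteq> S"

definition separable :: "nat list \<Rightarrow> bool" where
  "separable D \<longleftrightarrow> (\<exists>E S. edge_realization D E \<and> separates (length D) E S)"

lemma realization_iff:
  "realization D G \<longleftrightarrow> pverts G = {..<length D} \<and> edge_realization D (parcs G)"
proof -
  have deg: "out_degree (with_proj G) i = card (parcs G `` {i})" for i
  proof -
    have "out_arcs (with_proj G) i = Pair i ` (parcs G `` {i})"
      by (auto simp: out_arcs_def)
    then show ?thesis by (simp add: out_degree_def card_image inj_on_def)
  qed
  have "pair_graph G \<longleftrightarrow> finite (pverts G) \<and> parcs G \<subseteq> pverts G \<times> pverts G \<and>
      sym (parcs G) \<and> irrefl (parcs G)" (is "?L \<longleftrightarrow> ?R")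
  proof
    assume ?L
    then interpret pair_graph G .
    show ?R using pair_finite_verts in_arcsD1 in_arcsD2 pair_sym_arcs pair_no_loops
      by (force simp: symmetric_def irrefl_def)
  next
    assume r: ?R
    then have "finite (parcs G)" by (meson finite_SigmaI finite_subset)
    with r show ?L by unfold_locales (auto simp: symmetric_def irrefl_def)
  qed
  then show ?thesis by (auto simp: realization_def edge_realization_def deg)
qed

lemma handshake:
  assumes "edge_realization D E"
  shows "card E = sum_list D"
proof -
  have "E = Sigma {..<length D} (\<lambda>i. E `` {i})"
    using assms by (auto simp: edge_realization_def)
  then have "card E = card (Sigma {..<length D} (\<lambda>i. E `` {i}))" by (rule arg_cong)
  also have "\<dots> = (\<Sum>i<length D. card (E `` {i}))"
  proof (rule card_SigmaI)
    have "E `` {i} \<subseteq> {..<length D}" for i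
      using assms by (auto simp: edge_realization_def)
    then show "\<forall>i\<in>{..<length D}. finite (E `` {i})"
      by (meson finite_lessThan finite_subset)
  qed simp
  also have "\<dots> = (\<Sum>i<length D. D ! i)" using assms by (simp add: edge_realization_def)
  finally show ?thesis by (simp add: sum_list_sum_nth atLeast0LessThan)
qed

text \<open>By symmetry and irreflexivity, every fibre of the map from an arc to its pair of ends
  has exactly two elements.\<close>

lemma card_arcs_eq_edges:
  assumes "finite E" "sym E" "irrefl E"
  shows "card E = 2 * card {{u, v} | u v. (u, v) \<in> E}"
proof -
  let ?f = "\<lambda>(u, v). {u, v}"
  have im: "{{u, v} | u v. (u, v) \<in> E} = ?f ` E" by auto
  have "card E = (\<Sum>e \<in> ?f ` E. card {a \<in> E. ?f a = e})"
    using assms(1) by (subst card_eq_sum, subst sum.image_gen[where g = ?f]) auto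
  also have "\<dots> = (\<Sum>e \<in> ?f ` E. 2)"
  proof (rule sum.cong)
    fix e assume "e \<in> ?f ` E"
    then obtain u v where uv: "(u, v) \<in> E" "e = {u, v}" by auto
    then have "u \<noteq> v" using assms(3) by (auto simp: irrefl_def)
    moreover have "{a \<in> E. ?f a = e} = {(u, v), (v, u)}"
      using uv assms(2) by (auto simp: doubleton_eq_iff sym_def)
    ultimately show "card {a \<in> E. ?f a = e} = 2" by simp
  qed simp
  finally show ?thesis by (simp add: im)
qed

text \<open>A walk never leaves a closed set. Conversely, if \<open>v\<close> is not reachable from
  \<open>u\<close>, the set of vertices reachable from \<open>u\<close> separates. The empty digraph
  does not count as connected, whence \<open>length D > 0\<close>.\<close>

lemma connected_iff_not_separates:
  assumes "realization D G"
  shows "Digraph_Component.connected (with_proj G) \<longleftrightarrow>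
    length D > 0 \<and> \<not> (\<exists>S. separates (length D) (parcs G) S)"
proof -
  have V: "pverts G = {..<length D}" and er: "edge_realization D (parcs G)"
    using assms by (auto simp: realization_iff)
  interpret pair_graph G using assms by (simp add: realization_def)
  have symcl: "(parcs G)\<^sup>s = parcs G"
    using er by (auto simp: symcl_def edge_realization_def sym_def)
  have conv: "Digraph_Component.connected (with_proj G) \<longleftrightarrow> length D > 0 \<and>
      (\<forall>u<length D. \<forall>v<length D. (u, v) \<in> rtrancl_on {..<length D} (parcs G))"
    using V symcl by (auto simp: connected_conv)
  have reach: "v \<in> S" if "(u, v) \<in> rtrancl_on {..<length D} (parcs G)"
      "separates (length D) (parcs G) S" "u \<in> S" for u v S
    using that by (induction rule: rtrancl_on_induct) (auto simp: separates_def)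
  show ?thesis
  proof
    assume c: "Digraph_Component.connected (with_proj G)"
    have False if s: "separates (length D) (parcs G) S" for S
    proof -
      obtain u v where "u \<in> S" "u < length D" "v < length D" "v \<notin> S"
        using s by (fastforce simp: separates_def)
      with c conv reach s show False by blast
    qed
    with c conv show "length D > 0 \<and> \<not> (\<exists>S. separates (length D) (parcs G) S)" by blast
  next
    assume a: "length D > 0 \<and> \<not> (\<exists>S. separates (length D) (parcs G) S)"
    have "(u, v) \<in> rtrancl_on {..<length D} (parcs G)" if u: "u < length D" and v: "v < length D" for u v
    proof (rule ccontr)
      assume n: "(u, v) \<notin> rtrancl_on {..<length D} (parcs G)"
      let ?S = "{w. (u, w) \<in> rtrancl_on {..<length D} (parcs G)}"
      have "?S \<subseteq> {..<length D}" by (auto dest: in_rtrancl_on_in_F)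
      moreover have "parcs G `` ?S \<subseteq> ?S"
        using V in_arcsD2 by (auto intro: rtrancl_on_into_rtrancl_on)
      moreover have "u \<in> ?S" "v \<notin> ?S" using u n by auto
      ultimately have "separates (length D) (parcs G) ?S"
        using v unfolding separates_def by blast
      with a show False by blast
    qed
    with a conv show "Digraph_Component.connected (with_proj G)" by blast
  qed
qed

text \<open>The number of edges is half the degree sum, so the edge condition depends on
  \<open>D\<close> alone, and only connectedness can vary between realizations.\<close>

lemma forcibly_bicyclic_iff:
  "forcibly_graphic bicyclic D \<longleftrightarrow>
     realizable D \<and> \<not> separable D \<and> sum_list D = 2 * length D + 2"
proof -
  have bic: "bicyclic G \<longleftrightarrow> \<not> (\<exists>S. separates (length D) (parcs G) S) \<and> sum_list D = 2 * length D + 2"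
    if r: "realization D G" for G
  proof -
    have er: "edge_realization D (parcs G)" and V: "pverts G = {..<length D}"
      using r by (auto simp: realization_iff)
    interpret pair_graph G using r by (simp add: realization_def)
    have "finite (parcs G)" by (rule pair_finite_arcs)
    then have "card (parcs G) = 2 * card (undirected_edges G)"
      unfolding undirected_edges_def
      using er by (intro card_arcs_eq_edges) (auto simp: edge_realization_def)
    then have "sum_list D = 2 * card (undirected_edges G)"
      using handshake[OF er] by simp
    moreover have "pair_graph G" using r by (simp add: realization_def)
    \<comment> \<open>The sum condition already forces \<open>length D > 0\<close>, since the empty
      list has sum 0.\<close>
    ultimately show ?thesis
      unfolding bicyclic_def connected_iff_not_separates[OF r] V by fastforce
  qed
  have ex: "(\<exists>G. realization D G \<and> P (parcs G)) \<longleftrightarrow> (\<exists>E. edge_realization D E \<and> P E)" for P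
  proof
    assume "\<exists>E. edge_realization D E \<and> P E"
    then obtain E where "edge_realization D E" "P E" by blast
    then show "\<exists>G. realization D G \<and> P (parcs G)"
      by (intro exI[of _ "\<lparr>pverts = {..<length D}, parcs = E\<rparr>"]) (simp add: realization_iff)
  qed (auto simp: realization_iff)
  have "realizable D \<longleftrightarrow> graphic D"
    using ex[of "\<lambda>_. True"] by (simp add: realizable_def graphic_def)
  moreover have "separable D \<longleftrightarrow> (\<exists>G. realization D G \<and> (\<exists>S. separates (length D) (parcs G) S))"
    using ex[of "\<lambda>E. \<exists>S. separates (length D) E S"] by (auto simp: separable_def)
  ultimately show ?thesis
    unfolding forcibly_graphic_def by (metis bic graphic_def)
qed

section \<open>Relabelling vertices and disjoint unions\<close>

lemma edge_realization_permute:
  assumes er: "edge_realization D E" and p: "p permutes {..<length D}"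
  shows "edge_realization (permute_list p D) (inv_image E p)"
proof -
  have "card (inv_image E p `` {i}) = card (E `` {p i})" for i
  proof -
    have "inv_image E p `` {i} = p -` (E `` {p i})" by (auto simp: inv_image_def)
    then show ?thesis
      using permutes_inj[OF p] permutes_surj[OF p] by (simp add: card_vimage_inj)
  qed
  moreover have "p i < length D \<longleftrightarrow> i < length D" for i
    using permutes_in_image[OF p] by (metis lessThan_iff)
  ultimately show ?thesis using er
    by (auto simp: edge_realization_def inv_image_def sym_def irrefl_def permute_list_nth[OF p])
qed

text \<open>The constructions below produce entries in whatever order is convenient; this allows
  them to be rearranged afterwards.\<close>

lemma realizable_mset_cong:
  assumes "realizable D" "mset D = mset D'"
  shows "realizable D'"
  using assms edge_realization_permute mset_eq_permutation unfolding realizable_def by metis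

lemma separable_mset_cong:
  assumes "separable D" "mset D = mset D'"
  shows "separable D'"
proof -
  obtain E S where er: "edge_realization D E" and s: "separates (length D) E S"
    using assms by (auto simp: separable_def)
  obtain p where p: "p permutes {..<length D}" "permute_list p D = D'"
    using mset_eq_permutation[OF assms(2)[symmetric]] assms(2) by (metis size_mset)
  have "p i < length D \<longleftrightarrow> i < length D" for i
    using permutes_in_image[OF p(1)] by (metis lessThan_iff)
  moreover have "p -` S \<noteq> p -` {..<length D}" "p -` S \<noteq> {}"
    using s permutes_surj[OF p(1)] by (metis psubset_eq separates_def surj_image_vimage_eq image_empty)+
  ultimately have "separates (length D) (inv_image E p) (p -` S)"
    using s by (auto simp: separates_def inv_image_def)
  moreover have "edge_realization D' (inv_image E p)"
    using edge_realization_permute[OF er p(1)] p(2) by simp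
  moreover have "length D' = length D" using assms(2) by (metis size_mset)
  ultimately show ?thesis by (auto simp: separable_def)
qed

text \<open>This is the disjoint union, with the vertices of the second graph shifted by
  \<open>length D\<close>.\<close>

lemma edge_realization_append:
  assumes "edge_realization D E" "edge_realization D' E'"
  shows "edge_realization (D @ D') (E \<union> map_prod ((+) (length D)) ((+) (length D)) ` E')"
    (is "edge_realization _ ?F")
proof -
  have 1: "?F `` {i} = E `` {i}" if "i < length D" for i using that by auto
  have 2: "?F `` {length D + i} = (+) (length D) ` (E' `` {i})" for i
    using assms(1) by (force simp: edge_realization_def)
  have "card (?F `` {i}) = (D @ D') ! i" if "i < length (D @ D')" for i
  proof (cases "i < length D")
    case True
    then show ?thesis using 1 assms(1) by (simp add: nth_append edge_realization_def)
  next
    case False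
    then obtain j where "i = length D + j" by (metis le_Suc_ex not_less)
    then show ?thesis using 2[of j] assms(2) that
      by (simp add: nth_append edge_realization_def card_image)
  qed
  moreover have "?F \<subseteq> {..<length (D @ D')} \<times> {..<length (D @ D')}"
    using assms by (force simp: edge_realization_def)
  moreover have "sym ?F"
    using assms unfolding edge_realization_def sym_def by fast
  moreover have "irrefl ?F"
    using assms by (auto simp: edge_realization_def irrefl_def)
  ultimately show ?thesis by (simp add: edge_realization_def)
qed

lemma realizable_append: "realizable D \<Longrightarrow> realizable D' \<Longrightarrow> realizable (D @ D')"
  unfolding realizable_def using edge_realization_append by blast

lemma separable_append:
  assumes "realizable D" "realizable D'" "D \<noteq> []" "D' \<noteq> []"
  shows "separable (D @ D')"
proof -
  obtain E E' where er: "edge_realization D E" "edge_realization D' E'"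
    using assms by (auto simp: realizable_def)
  let ?F = "E \<union> map_prod ((+) (length D)) ((+) (length D)) ` E'"
  have "?F `` {..<length D} \<subseteq> {..<length D}" using er by (auto simp: edge_realization_def)
  moreover have "{..<length D} \<subset> {..<length (D @ D')}" "{..<length D} \<noteq> {}"
    using assms(3,4) by (auto simp: lessThan_strict_subset_iff lessThan_empty_iff)
  ultimately have "separates (length (D @ D')) ?F {..<length D}"
    unfolding separates_def by blast
  then show ?thesis unfolding separable_def using edge_realization_append[OF er] by blast
qed

subsection \<open>Constructions of realizations\<close>

lemma realizable_Nil: "realizable []"
  unfolding realizable_def edge_realization_def by (intro exI[of _ "{}"]) (auto simp: sym_def irrefl_def)

text \<open>The cone: a new vertex is joined to all old ones. It receives the last index and is then
  moved to the front by a permutation.\<close>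

lemma realizable_dominate:
  assumes "realizable D"
  shows "realizable (length D # map Suc D)"
proof -
  obtain E where er: "edge_realization D E" using assms by (auto simp: realizable_def)
  let ?n = "length D"
  let ?F = "E \<union> {..<?n} \<times> {?n} \<union> {?n} \<times> {..<?n}"
  have "card (?F `` {i}) = Suc (D ! i)" if "i < ?n" for i
  proof -
    have eq: "?F `` {i} = insert ?n (E `` {i})" using that by auto
    have "E `` {i} \<subseteq> {..<?n}" using er by (auto simp: edge_realization_def)
    then have "finite (E `` {i})" "?n \<notin> E `` {i}" by (auto intro: finite_subset)
    then show ?thesis unfolding eq using er that by (simp add: edge_realization_def)
  qed
  moreover have "?F `` {?n} = {..<?n}" using er by (auto simp: edge_realization_def)
  ultimately have "card (?F `` {i}) = (map Suc D @ [?n]) ! i" if "i < Suc ?n" for i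
    using that by (cases "i = ?n") (simp_all add: nth_append)
  moreover have "sym ?F" using er by (auto simp: edge_realization_def sym_def)
  ultimately have "edge_realization (map Suc D @ [?n]) ?F"
    using er by (auto simp: edge_realization_def irrefl_def)
  then have "realizable (map Suc D @ [?n])" by (auto simp: realizable_def)
  then show ?thesis by (rule realizable_mset_cong) simp
qed

lemma realizable_leaf:
  assumes "realizable D" "i < length D"
  shows "realizable (D[i := Suc (D ! i)] @ [1])"
proof -
  obtain E where er: "edge_realization D E" using assms by (auto simp: realizable_def)
  let ?n = "length D"
  let ?F = "E \<union> {(i, ?n), (?n, i)}"
  have "card (?F `` {j}) = (D[i := Suc (D ! i)] @ [1]) ! j" if "j < Suc ?n" for j
  proof -
    have "j \<noteq> i \<Longrightarrow> j \<noteq> ?n \<Longrightarrow> ?F `` {j} = E `` {j}" by auto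
    moreover have "?F `` {?n} = {i}" "?F `` {i} = insert ?n (E `` {i})" "?n \<notin> E `` {i}" "finite (E `` {i})"
      using assms(2) er by (auto simp: edge_realization_def intro: finite_subset[of _ "{..<?n}"])
    ultimately show ?thesis using er that assms(2)
      by (cases "j = ?n"; cases "j = i") (auto simp: edge_realization_def nth_append)
  qed
  then have "edge_realization (D[i := Suc (D ! i)] @ [1]) ?F"
    using er assms(2) by (auto simp: edge_realization_def sym_def irrefl_def)
  then show ?thesis by (auto simp: realizable_def)
qed

text \<open>A positive entry guarantees an edge, and subdividing it adds a vertex of degree 2
  without changing the other degrees.\<close>

lemma realizable_subdivide:
  assumes "realizable D" "x \<in> set D" "x > 0"
  shows "realizable (D @ [2])"
proof -
  obtain E where er: "edge_realization D E" using assms by (auto simp: realizable_def)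
  let ?n = "length D"
  obtain u where "u < ?n" "D ! u > 0" using assms by (auto simp: in_set_conv_nth)
  then have "card (E `` {u}) > 0" using er by (auto simp: edge_realization_def)
  then obtain v where v: "(u, v) \<in> E" by (auto simp: card_gt_0_iff)
  then have uv: "u < ?n" "v < ?n" "u \<noteq> v" "(v, u) \<in> E"
    using er by (auto simp: edge_realization_def irrefl_def sym_def)
  let ?F = "E - {(u, v), (v, u)} \<union> {(u, ?n), (?n, u), (v, ?n), (?n, v)}"
  have fin: "finite (E `` {j})" and nE: "?n \<notin> E `` {j}" "(?n, j) \<notin> E" for j
    using er by (auto simp: edge_realization_def intro: finite_subset[of _ "{..<?n}"])
  \<comment> \<open>Each end of the subdivided edge trades its old neighbour for the new vertex
    \<open>?n\<close>, so its degree is unchanged.\<close>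
  have swap: "card (insert ?n (E `` {j} - {w})) = card (E `` {j})" if "w \<in> E `` {j}" for j w
    using that fin nE card_Suc_Diff1[OF fin that] by simp
  have "card (?F `` {j}) = (D @ [2]) ! j" if "j < Suc ?n" for j
  proof -
    have "j \<noteq> u \<Longrightarrow> j \<noteq> v \<Longrightarrow> j \<noteq> ?n \<Longrightarrow> ?F `` {j} = E `` {j}" by auto
    moreover have "?F `` {u} = insert ?n (E `` {u} - {v})" "?F `` {v} = insert ?n (E `` {v} - {u})"
      "?F `` {?n} = {u, v}"
      using uv nE by auto
    ultimately show ?thesis using er that uv swap[of v u] swap[of u v] v
      by (cases "j = ?n"; cases "j = u"; cases "j = v") (auto simp: edge_realization_def nth_append)
  qed
  moreover have "sym ?F" using er by (auto simp: edge_realization_def sym_def)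
  ultimately have "edge_realization (D @ [2]) ?F"
    using er uv by (auto simp: edge_realization_def irrefl_def)
  then show ?thesis by (auto simp: realizable_def)
qed

lemma realizable_append_twos:
  assumes "realizable D" "x \<in> set D" "x > 0"
  shows "realizable (D @ replicate m 2)"
proof (induction m)
  case (Suc m)
  then have "realizable ((D @ replicate m 2) @ [2])"
    using assms by (intro realizable_subdivide[of _ x]) auto
  then show ?case by (simp add: replicate_append_same)
qed (use assms in simp)

text \<open>The degrees that \<open>c\<close> lacks compared with \<open>b\<close> add up to
  \<open>p\<close>, so \<open>p\<close> leaves can be hung one by one at deficient vertices.\<close>

lemma realizable_attach_leaves:
  assumes "realizable c" "list_all2 (\<le>) c b" "sum_list b = sum_list c + p"
  shows "realizable (b @ replicate p 1)"
  using assms(2,3)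
proof (induction p arbitrary: b)
  case 0
  \<comment> \<open>Without leaves the sums agree, and a pointwise inequality with equal sums is an
    equality.\<close>
  have "c = b"
  proof (rule ccontr)
    assume "c \<noteq> b"
    moreover have l: "length c = length b" "\<forall>i<length c. c ! i \<le> b ! i"
      using 0 by (auto simp: list_all2_conv_all_nth)
    ultimately obtain i where "i < length c" "c ! i < b ! i" by (metis nat_less_le nth_equalityI)
    then have "sum ((!) c) {0..<length c} < sum ((!) b) {0..<length c}"
      using l by (intro sum_strict_mono_ex1) auto
    then show False using 0 l by (simp add: sum_list_sum_nth)
  qed
  then show ?case using assms(1) by simp
next
  case (Suc p)
  have l: "length c = length b" "\<forall>i<length c. c ! i \<le> b ! i"
    using Suc by (auto simp: list_all2_conv_all_nth)
  have "c \<noteq> b" using Suc by auto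
  with l obtain i where i: "i < length b" "c ! i < b ! i" by (metis nat_less_le nth_equalityI)
  \<comment> \<open>One unit of deficiency at \<open>i\<close> is set aside for the last leaf, and
    the induction hypothesis takes care of the rest.\<close>
  let ?b = "b[i := b ! i - 1]"
  have "list_all2 (\<le>) c ?b" using l i by (auto simp: list_all2_conv_all_nth nth_list_update)
  moreover have "sum_list ?b = sum_list c + p"
    using i Suc.prems(2) by (simp add: sum_list_update)
  ultimately have "realizable (?b @ replicate p 1)" by (rule Suc.IH)
  from realizable_leaf[OF this, of i] i show ?case
    by (simp add: nth_append list_update_append replicate_append_same)
qed

section \<open>Small base graphs as iterated cones, lengthened by subdivision\<close>

lemma realizable_K1: "realizable [0]"
  using realizable_dominate[OF realizable_Nil] by simp

lemma realizable_K2: "realizable [1, 1]"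
  using realizable_dominate[OF realizable_K1] by simp

lemma realizable_triangle: "realizable [2, 2, 2]"
  using realizable_dominate[OF realizable_K2] by (simp add: numeral_2_eq_2)

lemma realizable_K4: "realizable [3, 3, 3, 3]"
  using realizable_dominate[OF realizable_triangle] by (simp add: numeral_3_eq_3)

lemma realizable_path: "realizable [2, 1, 1]"
  using realizable_dominate[OF realizable_append[OF realizable_K1 realizable_K1]]
  by (simp add: numeral_2_eq_2)

text \<open>The cone over a path on three vertices is \<open>K4\<close> minus an edge.\<close>

lemma realizable_diamond_twos: "realizable ([3, 3, 2, 2] @ replicate m 2)"
proof -
  have "realizable [3, 3, 2, 2]"
    using realizable_dominate[OF realizable_path] by (simp add: numeral_eq_Suc)
  then show ?thesis by (rule realizable_append_twos[of _ 2]) auto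
qed

text \<open>The cone over two disjoint edges: two triangles sharing a vertex.\<close>

lemma realizable_4_twos: "realizable ([4, 2, 2, 2, 2] @ replicate m 2)"
proof -
  have "realizable [4, 2, 2, 2, 2]"
    using realizable_dominate[OF realizable_append[OF realizable_K2 realizable_K2]]
    by (simp add: numeral_eq_Suc)
  then show ?thesis by (rule realizable_append_twos[of _ 2]) auto
qed

text \<open>The cone over three disjoint edges: three triangles sharing a vertex.\<close>

lemma realizable_6_twos: "realizable ([6, 2, 2, 2, 2, 2, 2] @ replicate m 2)"
proof -
  have "realizable [6, 2, 2, 2, 2, 2, 2]"
    using realizable_dominate[OF realizable_append[OF realizable_append[OF realizable_K2 realizable_K2] realizable_K2]]
    by (simp add: numeral_eq_Suc)
  then show ?thesis by (rule realizable_append_twos[of _ 2]) auto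
qed

text \<open>The cone over a three-vertex path and a disjoint edge.\<close>

lemma realizable_5_3_twos: "realizable ([5, 3, 2, 2, 2, 2] @ replicate m 2)"
proof -
  have "realizable [5, 3, 2, 2, 2, 2]"
    using realizable_dominate[OF realizable_append[OF realizable_path realizable_K2]]
    by (simp add: numeral_eq_Suc)
  then show ?thesis by (rule realizable_append_twos[of _ 2]) auto
qed

text \<open>The cone over a star with three leaves: three triangles sharing an edge.\<close>

lemma realizable_4_4_twos: "realizable ([4, 4, 2, 2, 2] @ replicate m 2)"
proof -
  have "realizable [3, 1, 1, 1]"
    using realizable_dominate[OF realizable_append[OF realizable_append[OF realizable_K1 realizable_K1] realizable_K1]]
    by (simp add: numeral_eq_Suc)
  from realizable_dominate[OF this] have "realizable [4, 4, 2, 2, 2]"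
    by (simp add: numeral_eq_Suc)
  then show ?thesis by (rule realizable_append_twos[of _ 2]) auto
qed

text \<open>The cone over a path on four vertices, which arises by subdividing the path on
  three.\<close>

lemma realizable_4_3_3_twos: "realizable ([4, 3, 3, 2, 2] @ replicate m 2)"
proof -
  have "realizable ([2, 1, 1] @ [2])"
    by (rule realizable_subdivide[OF realizable_path, of 2]) auto
  from realizable_dominate[OF this] have "realizable [4, 3, 2, 2, 3]"
    by (simp add: numeral_eq_Suc)
  then have "realizable [4, 3, 3, 2, 2]" by (rule realizable_mset_cong) simp
  then show ?thesis by (rule realizable_append_twos[of _ 2]) auto
qed

lemma realizable_K4_twos: "realizable ([3, 3, 3, 3] @ replicate m 2)"
  by (rule realizable_append_twos[OF realizable_K4, of 3]) auto

section \<open>Disconnected realizations\<close>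

text \<open>Two of the \<open>p\<close> ones form a separate \<open>K2\<close>; the other
  \<open>p - 2\<close> are hung on the core \<open>c\<close>. This accounts for the shift by 2 in
  the sum condition.\<close>

lemma separable_attach_leaves:
  assumes "realizable c" "list_all2 (\<le>) c b" "c \<noteq> []" "sum_list b + 2 = sum_list c + p" "p \<ge> 2"
  shows "separable (b @ replicate p 1)"
proof -
  have "realizable (b @ replicate (p - 2) 1)"
    using assms by (intro realizable_attach_leaves[of c]) auto
  then have "separable ((b @ replicate (p - 2) 1) @ [1, 1])"
    using assms by (intro separable_append realizable_K2) auto
  moreover have "replicate (p - 2) 1 @ [1, 1] = replicate p (1 :: nat)"
    using \<open>p \<ge> 2\<close> by (metis add_2_eq_Suc' le_add_diff_inverse2 replicate_Suc replicate_append_same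
        append.assoc append_Cons append_Nil)
  ultimately show ?thesis by simp
qed

text \<open>Here a triangle is split off instead, so all \<open>p\<close> leaves stay with the core
  and \<open>p\<close> may be 0 or 1.\<close>

lemma separable_triangle_attach_leaves:
  assumes "realizable c" "list_all2 (\<le>) c b" "c \<noteq> []" "sum_list b = sum_list c + p"
  shows "separable (b @ [2, 2, 2] @ replicate p 1)"
proof -
  have "separable ((b @ replicate p 1) @ [2, 2, 2])"
    using assms by (intro separable_append realizable_triangle realizable_attach_leaves[of c]) auto
  then show ?thesis by (rule separable_mset_cong) simp
qed

subsection \<open>Criteria for connectedness of all realizations\<close>

lemma edge_realization_finite: "edge_realization D E \<Longrightarrow> finite E"
  unfolding edge_realization_def by (meson finite_SigmaI finite_lessThan finite_subset)

lemma edge_realization_degree: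
  assumes "edge_realization D E" "i < length D"
  shows "finite (E `` {i})" "card (E `` {i}) = D ! i"
proof -
  have "E `` {i} \<subseteq> {..<length D}" using assms by (auto simp: edge_realization_def)
  then show "finite (E `` {i})" by (rule finite_subset) simp
qed (use assms in \<open>simp add: edge_realization_def\<close>)

text \<open>All neighbours of \<open>i\<close> lie in \<open>T\<close>, and \<open>i\<close> is not
  one of them.\<close>

lemma degree_less_closed:
  assumes er: "edge_realization D E" and T: "finite T" "E `` T \<subseteq> T" "i \<in> T" "i < length D"
  shows "D ! i < card T"
proof -
  have "E `` {i} \<subset> T" using er T by (auto simp: edge_realization_def irrefl_def)
  then show ?thesis
    using psubset_card_mono[OF T(1)] edge_realization_degree(2)[OF er T(4)] by metis
qed

lemma degree_less_length:
  assumes "edge_realization D E" "i < length D"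
  shows "D ! i < length D"
  using degree_less_closed[OF assms(1), of "{..<length D}" i] assms
  by (auto simp: edge_realization_def)

text \<open>By symmetry, an arc leaving the complement would reverse to an arc leaving
  \<open>S\<close>.\<close>

lemma separates_Compl:
  assumes er: "edge_realization D E" and s: "separates (length D) E S"
  shows "separates (length D) E ({..<length D} - S)"
proof -
  have "j \<in> {..<length D} - S" if "i \<in> {..<length D} - S" "(i, j) \<in> E" for i j
    using that er s unfolding edge_realization_def separates_def sym_def by blast
  then have "E `` ({..<length D} - S) \<subseteq> {..<length D} - S" by blast
  then show ?thesis using s unfolding separates_def by blast
qed

lemma card_arcs_within:
  assumes "finite S" "irrefl E"
  shows "card (E \<inter> S \<times> S) \<le> card S * (card S - 1)"
proof -
  have "E \<inter> S \<times> S \<subseteq> Sigma S (\<lambda>i. S - {i})" using assms(2) by (auto simp: irrefl_def)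
  then have "card (E \<inter> S \<times> S) \<le> card (Sigma S (\<lambda>i. S - {i}))"
    using assms(1) by (intro card_mono) auto
  also have "\<dots> = card S * (card S - 1)" using assms(1) by simp
  finally show ?thesis .
qed

lemma card_arcs_from:
  assumes er: "edge_realization D E" and A: "A \<subseteq> {..<length D}"
  shows "card (E \<inter> A \<times> UNIV) = (\<Sum>i\<in>A. D ! i)"
proof -
  have "E \<inter> A \<times> UNIV = Sigma A (\<lambda>i. E `` {i})" by auto
  then have "card (E \<inter> A \<times> UNIV) = card (Sigma A (\<lambda>i. E `` {i}))" by (rule arg_cong)
  also have "\<dots> = (\<Sum>i\<in>A. card (E `` {i}))"
    using edge_realization_degree(1)[OF er] A
    by (intro card_SigmaI) (auto intro: finite_subset)
  also have "\<dots> = (\<Sum>i\<in>A. D ! i)"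
    using edge_realization_degree(2)[OF er] A by (intro sum.cong) auto
  finally show ?thesis .
qed

lemma card_arcs_swap:
  assumes "sym E"
  shows "card (E \<inter> A \<times> B) = card (E \<inter> B \<times> A)"
proof -
  have "E \<inter> B \<times> A = prod.swap ` (E \<inter> A \<times> B)" using assms by (force simp: sym_def)
  then show ?thesis by (metis card_image inj_swap)
qed

text \<open>
  Every arc from a big vertex to a leaf uses up a leaf outside \<open>C\<close>. The set \<open>C\<close> will be a union of
  components without big vertices.
\<close>

lemma card_arcs_among_big:
  assumes er: "edge_realization (b @ replicate p 1) E"
    and C: "C \<subseteq> {length b..<length b + p}" "E `` C \<inter> {..<length b} = {}"
  shows "sum_list b + card C \<le> card (E \<inter> {..<length b} \<times> {..<length b}) + p"
proof -
  let ?B = "{..<length b}" and ?L = "{length b..<length b + p}"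
  have E: "E \<subseteq> {..<length b + p} \<times> {..<length b + p}" "sym E"
    using er by (auto simp: edge_realization_def)
  have "sum_list b = (\<Sum>i\<in>?B. (b @ replicate p 1) ! i)"
    by (simp add: sum_list_sum_nth atLeast0LessThan nth_append)
  also have "\<dots> = card (E \<inter> ?B \<times> UNIV)"
    by (rule card_arcs_from[OF er, symmetric]) auto
  also have "E \<inter> ?B \<times> UNIV = (E \<inter> ?B \<times> ?B) \<union> (E \<inter> ?B \<times> ?L)" using E by fastforce
  also have "card \<dots> \<le> card (E \<inter> ?B \<times> ?B) + card (E \<inter> ?B \<times> ?L)" by (rule card_Un_le)
  also have "card (E \<inter> ?B \<times> ?L) = card (E \<inter> ?L \<times> ?B)" by (rule card_arcs_swap[OF E(2)])
  also have "card (E \<inter> ?L \<times> ?B) \<le> card (E \<inter> (?L - C) \<times> UNIV)"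
    using C(2) edge_realization_finite[OF er] by (intro card_mono) auto
  also have "\<dots> = (\<Sum>i\<in>?L - C. (b @ replicate p 1) ! i)"
    by (rule card_arcs_from[OF er]) auto
  also have "\<dots> = (\<Sum>i\<in>?L - C. 1)" by (rule sum.cong) (auto simp: nth_append)
  also have "\<dots> = p - card C"
    using C(1) finite_subset[OF C(1)] by (simp add: card_Diff_subset)
  finally have "sum_list b \<le> card (E \<inter> ?B \<times> ?B) + (p - card C)" by simp
  moreover have "card C \<le> p" using card_mono[OF _ C(1)] by simp
  ultimately show ?thesis by simp
qed

text \<open>The \<open>k\<close> big vertices span at least \<open>2 * k + 2\<close> arcs, but at
  most \<open>k * (k - 1)\<close>, which is at most \<open>2 * k\<close> for
  \<open>k \<le> 3\<close>.\<close>

lemma length_big_ge_4: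
  assumes "realizable (b @ replicate p 1)" "sum_list b = p + 2 * length b + 2"
  shows "length b \<ge> 4"
proof (rule ccontr)
  assume n: "\<not> length b \<ge> 4"
  obtain E where er: "edge_realization (b @ replicate p 1) E" using assms by (auto simp: realizable_def)
  have "2 * length b + 2 \<le> card (E \<inter> {..<length b} \<times> {..<length b})"
    using card_arcs_among_big[OF er, of "{}"] assms(2) by simp
  also have "\<dots> \<le> length b * (length b - 1)"
    using card_arcs_within[of "{..<length b}" E] er by (simp add: edge_realization_def)
  also have "\<dots> \<le> length b * 2" using n by (intro mult_left_mono) auto
  finally show False by simp
qed

text \<open>The four big vertices span exactly 10 arcs. A separating set that avoids them would
  raise the lower bound above 10; one that divides them would leave at most 6 arcs.\<close>

lemma not_separable_four_big:
  assumes "r + s + t = p + 8"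
  shows "\<not> separable ([r, s, t, 2] @ replicate p 1)" (is "\<not> separable ?D")
proof
  assume "separable ?D"
  then obtain E S where er: "edge_realization ?D E" and s: "separates (length ?D) E S"
    by (auto simp: separable_def)
  let ?B = "{..<4 :: nat}"
  note sym = er[unfolded edge_realization_def, THEN conjunct2, THEN conjunct1]
  note irrefl = er[unfolded edge_realization_def, THEN conjunct2, THEN conjunct2, THEN conjunct1]
  note fin = edge_realization_finite[OF er]
  have big: "10 + card C \<le> card (E \<inter> ?B \<times> ?B)"
    if "C \<subseteq> {4..<4 + p}" "E `` C \<inter> ?B = {}" for C
  proof -
    have len: "length [r, s, t, 2] = 4" and sum: "sum_list [r, s, t, 2] = p + 10"
      using assms by simp_all
    show ?thesis using card_arcs_among_big[OF er, unfolded len sum, OF that] by linarith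
  qed
  \<comment> \<open>There are at most six arcs among vertices 0, 1, 2, plus two out of vertex 3 and
    two into it.\<close>
  have le10: "card (E \<inter> ?B \<times> ?B) \<le> 10"
  proof -
    have "E \<inter> ?B \<times> ?B \<subseteq> E \<inter> {..<3} \<times> {..<3} \<union> (E \<inter> {3} \<times> UNIV \<union> E \<inter> UNIV \<times> {3})"
      by force
    then have "card (E \<inter> ?B \<times> ?B) \<le>
        card (E \<inter> {..<3} \<times> {..<3} \<union> (E \<inter> {3} \<times> UNIV \<union> E \<inter> UNIV \<times> {3}))"
      by (rule card_mono[rotated]) (use fin in simp)
    also have "\<dots> \<le> card (E \<inter> {..<3} \<times> {..<3}) + (card (E \<inter> {3} \<times> UNIV) + card (E \<inter> UNIV \<times> {3}))"
      by (meson add_left_mono card_Un_le order_trans)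
    also have "card (E \<inter> UNIV \<times> {3}) = card (E \<inter> {3} \<times> UNIV)" by (rule card_arcs_swap[OF sym])
    also have "card (E \<inter> {3} \<times> UNIV) = 2"
      using card_arcs_from[OF er, of "{3}"] by simp
    finally show ?thesis using card_arcs_within[of "{..<3}" E] irrefl by simp
  qed
  \<comment> \<open>A side without big vertices consists of leaves and can serve as \<open>C\<close>
    in the arc count.\<close>
  have False if T: "separates (length ?D) E T" "?B \<inter> T = {}" for T
  proof -
    have "i \<in> {4..<4 + p}" if "i \<in> T" for i
    proof -
      have "i < 4 + p" using T(1) that by (auto simp: separates_def)
      moreover have "\<not> i < 4" using T(2) that by auto
      ultimately show ?thesis by simp
    qed
    then have "T \<subseteq> {4..<4 + p}" by blast
    moreover have "E `` T \<inter> ?B = {}" using T by (auto simp: separates_def)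
    ultimately have "10 + card T \<le> 10" using big le10 order_trans by blast
    then have "card T = 0" by simp
    moreover have "finite T" using T(1) by (meson finite_lessThan finite_subset psubset_imp_subset separates_def)
    ultimately show False using T(1) by (simp add: separates_def)
  qed
  from this[OF s] this[OF separates_Compl[OF er s]]
  have X: "?B \<inter> S \<noteq> {}" "?B - S \<noteq> {}" by auto
  have "E \<inter> ?B \<times> ?B \<subseteq> E \<inter> (?B \<inter> S) \<times> (?B \<inter> S) \<union> E \<inter> (?B - S) \<times> (?B - S)"
    using s sym by (auto simp: separates_def sym_def)
  then have "card (E \<inter> ?B \<times> ?B) \<le> card (E \<inter> (?B \<inter> S) \<times> (?B \<inter> S) \<union> E \<inter> (?B - S) \<times> (?B - S))"
    by (rule card_mono[rotated]) (use fin in simp)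
  also have "\<dots> \<le> card (E \<inter> (?B \<inter> S) \<times> (?B \<inter> S)) + card (E \<inter> (?B - S) \<times> (?B - S))"
    by (rule card_Un_le)
  also have "\<dots> \<le> card (?B \<inter> S) * (card (?B \<inter> S) - 1) + card (?B - S) * (card (?B - S) - 1)"
    using irrefl by (intro add_mono card_arcs_within) auto
  \<comment> \<open>A division into 1 and 3 leaves at most 6 arcs, a division into 2 and 2 at most
    4.\<close>
  also have "\<dots> \<le> 6"
  proof -
    have "card (?B \<inter> S) + card (?B - S) = 4"
      using card_Int_Diff[of ?B S] by simp
    moreover have "card (?B \<inter> S) > 0" "card (?B - S) > 0" using X by (simp_all add: card_gt_0_iff)
    ultimately have "card (?B \<inter> S) = 1 \<and> card (?B - S) = 3 \<or> card (?B \<inter> S) = 2 \<and> card (?B - S) = 2 \<or>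
        card (?B \<inter> S) = 3 \<and> card (?B - S) = 1" by arith
    then show ?thesis by auto
  qed
  finally show False using big[of "{}"] by simp
qed

text \<open>Let \<open>T\<close> be the side without vertex 0. The other side contains vertex 0 and
  its \<open>D ! 0\<close> neighbours, which bounds \<open>card T\<close> from above; the degrees
  inside \<open>T\<close> bound it from below.\<close>

lemma separable_small_side:
  assumes "separable D"
  obtains E T where "edge_realization D E" "separates (length D) E T"
    "finite T" "0 \<notin> T" "D ! 0 + card T < length D" "\<And>i. i \<in> T \<Longrightarrow> i < length D \<and> D ! i < card T"
proof -
  obtain E S where er: "edge_realization D E" and s: "separates (length D) E S"
    using assms by (auto simp: separable_def)
  define T where "T = (if 0 \<in> S then {..<length D} - S else S)"
  have T: "separates (length D) E T" "0 \<notin> T"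
    using s separates_Compl[OF er s] by (auto simp: T_def)
  have fin: "finite T" using T(1) by (meson finite_lessThan finite_subset psubset_imp_subset separates_def)
  let ?U = "{..<length D} - T"
  have "D ! 0 < card ?U"
    using separates_Compl[OF er T(1)] T(2)
    by (intro degree_less_closed[OF er]) (auto simp: separates_def)
  also have "card ?U = length D - card T"
    using T(1) by (simp add: card_Diff_subset fin separates_def psubset_imp_subset)
  finally have "D ! 0 + card T < length D" by simp
  moreover have "i < length D \<and> D ! i < card T" if "i \<in> T" for i
    using degree_less_closed[OF er fin _ that] T(1) that by (auto simp: separates_def)
  ultimately show thesis using that er T fin by blast
qed

text \<open>The side of vertex 0 leaves room for at most one other vertex, which would then be
  isolated.\<close>

lemma not_separable_max_degree:
  assumes "\<forall>d\<in>set D. d \<ge> 1" "D ! 0 + 2 \<ge> length D"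
  shows "\<not> separable D"
proof
  assume "separable D"
  then obtain E T where T: "separates (length D) E T" "D ! 0 + card T < length D"
    "\<And>i. i \<in> T \<Longrightarrow> i < length D \<and> D ! i < card T"
    by (metis separable_small_side)
  then obtain i where "i \<in> T" by (auto simp: separates_def)
  with T(3) have i: "i < length D" "D ! i < card T" by auto
  with assms(1) have "D ! i \<ge> 1" by simp
  with i T(2) assms(2) show False by linarith
qed

text \<open>The small side has at most two vertices, too few to contain a vertex of degree at least
  2. It would therefore be a single leaf without a neighbour.\<close>

lemma not_separable_one_leaf:
  assumes "\<forall>d\<in>set b. d \<ge> 2" "p \<le> 1" "b \<noteq> []" "length b + p \<le> hd b + 3"
  shows "\<not> separable (b @ replicate p 1)" (is "\<not> separable ?D")
proof
  assume "separable ?D"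
  then obtain E T where T: "separates (length ?D) E T" "?D ! 0 + card T < length ?D" "finite T"
    "\<And>i. i \<in> T \<Longrightarrow> i < length ?D \<and> ?D ! i < card T"
    by (metis separable_small_side)
  have "?D ! 0 = hd b" using assms(3) by (simp add: nth_append hd_conv_nth)
  with T(2) assms(4) have two: "card T \<le> 2" by simp
  have "i \<in> {length b..<length b + p}" if "i \<in> T" for i
  proof (rule ccontr)
    assume "i \<notin> {length b..<length b + p}"
    with T(4)[OF that] have "i < length b" by auto
    with assms(1) have "?D ! i \<ge> 2" by (simp add: nth_append)
    with T(4)[OF that] two show False by linarith
  qed
  then have sub: "T \<subseteq> {length b..<length b + p}" by blast
  from card_mono[OF _ sub] assms(2) have one: "card T \<le> 1" by simp
  obtain i where "i \<in> T" using T(1) by (auto simp: separates_def)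
  with T(4) have i: "i < length ?D" "?D ! i < card T" by auto
  have "\<forall>d\<in>set ?D. d \<ge> 1" using assms(1) by auto
  with i one show False by (meson leD nth_mem order_less_le_trans)
qed

text \<open>The bound of \<open>not_separable_one_leaf\<close> fails by one here: the small side may
  have three vertices. Then the other side has four, three of them of degree 3, so it is a
  \<open>K4\<close>.\<close>

lemma not_separable_3332221: "\<not> separable [3, 3, 3, 2, 2, 2, 1]" (is "\<not> separable ?D")
proof
  assume "separable ?D"
  then obtain E T where er: "edge_realization ?D E" and T: "separates (length ?D) E T" "finite T"
    "?D ! 0 + card T < length ?D" "\<And>i. i \<in> T \<Longrightarrow> i < length ?D \<and> ?D ! i < card T"
    by (metis separable_small_side)
  have len: "length ?D = 7" by simp
  have c3: "card T \<le> 3" using T(3) by simp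
  have low: "?D ! i = 3" if "i < 3" for i
  proof -
    have "i = 0 \<or> i = 1 \<or> i = 2" using that by arith
    then show ?thesis by auto
  qed
  have mid: "?D ! i \<le> 2" if "i \<ge> 3" "i < 7" for i
  proof -
    have "i = 3 \<or> i = 4 \<or> i = 5 \<or> i = 6" using that by arith
    then show ?thesis by auto
  qed
  have two: "?D ! i \<ge> 2" if "i < 6" for i
  proof -
    have "i = 0 \<or> i = 1 \<or> i = 2 \<or> i = 3 \<or> i = 4 \<or> i = 5" using that by arith
    then show ?thesis by auto
  qed
  \<comment> \<open>In a set of at most two vertices only the leaf 6 has a small enough degree, and
    alone it has no neighbour.\<close>
  have "card T = 3"
  proof (rule ccontr)
    assume "card T \<noteq> 3"
    with c3 have c2: "card T \<le> 2" by simp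
    have "i = 6" if "i \<in> T" for i
    proof (rule ccontr)
      assume "i \<noteq> 6"
      with T(4)[OF that] have "i < 6" "?D ! i < card T" by auto
      with two c2 show False by fastforce
    qed
    moreover have "T \<noteq> {}" using T(1) by (simp add: separates_def)
    ultimately have "T = {6}" by auto
    then show False using T(4)[of 6] by simp
  qed
  have T3: "T \<subseteq> {3..<7}"
  proof
    fix i assume i: "i \<in> T"
    from T(4)[OF i] low c3 show "i \<in> {3..<7}" by (cases "i < 3") auto
  qed
  let ?U = "{..<7} - T"
  have "card ?U = 4" using T3 \<open>card T = 3\<close> by (subst card_Diff_subset) (auto simp: T(2))
  have U: "E `` ?U \<subseteq> ?U" using separates_Compl[OF er T(1)] unfolding separates_def len by blast
  \<comment> \<open>The three vertices of degree 3 see the whole of their 4-vertex side, so its fourth vertex has degree \<open>\<ge> 3\<close>.\<close>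
  have adj: "E `` {i} = ?U - {i}" if "i < 3" for i
  proof (rule card_seteq)
    have "i \<in> ?U" using that T3 by auto
    with U er show "E `` {i} \<subseteq> ?U - {i}" by (auto simp: edge_realization_def irrefl_def)
    have "card (E `` {i}) = 3" using edge_realization_degree(2)[OF er] low that by simp
    then show "card (?U - {i}) \<le> card (E `` {i})"
      using \<open>card ?U = 4\<close> \<open>i \<in> ?U\<close> by simp
  qed auto
  have "?U \<noteq> {..<3}" using \<open>card ?U = 4\<close> by (metis card_lessThan numeral_eq_iff semiring_norm(88))
  moreover have "{..<3} \<subseteq> ?U" using T3 by auto
  ultimately obtain w where w: "w \<in> ?U" "w \<ge> 3" by force
  have "{..<3} \<subseteq> E `` {w}"
  proof
    fix i :: nat assume i: "i \<in> {..<3}"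
    then have "w \<in> ?U - {i}" using w by auto
    with i adj[of i] have "(i, w) \<in> E" by blast
    then show "i \<in> E `` {w}" using er by (auto simp: edge_realization_def sym_def)
  qed
  moreover have "w < length ?D" using w by simp
  ultimately have "card {..<3::nat} \<le> ?D ! w"
    using edge_realization_degree[OF er] by (metis card_mono)
  then show False using mid w by fastforce
qed

subsection \<open>The classification\<close>

lemma sorted_pos_split_ones:
  assumes "sorted_wrt (\<ge>) D" "\<forall>d\<in>set D. d \<ge> (1 :: nat)"
  obtains b p where "D = b @ replicate p 1" "sorted_wrt (\<ge>) b" "\<forall>d\<in>set b. d \<ge> 2"
proof -
  have "\<exists>b p. D = b @ replicate p 1 \<and> sorted_wrt (\<ge>) b \<and> (\<forall>d\<in>set b. d \<ge> 2)"
    using assms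
  proof (induction D)
    case (Cons x D)
    show ?case
    proof (cases "x \<ge> 2")
      case True
      obtain b p where b: "D = b @ replicate p 1" "sorted_wrt (\<ge>) b" "\<forall>d\<in>set b. d \<ge> 2"
        using Cons by auto
      have "x # D = (x # b) @ replicate p 1" "sorted_wrt (\<ge>) (x # b)" "\<forall>d\<in>set (x # b). d \<ge> 2"
        using b True Cons.prems(1) by auto
      then show ?thesis by blast
    next
      case False
      then have "\<forall>d\<in>set (x # D). d = 1" using Cons.prems by fastforce
      then have "x # D = [] @ replicate (length (x # D)) 1"
        by (metis append_Nil replicate_eqI)
      then show ?thesis by (metis empty_iff list.set(1) sorted_wrt.simps(1))
    qed
  qed simp
  with that show thesis by blast
qed

lemma list_all2_replicate_le:
  "length xs = m \<Longrightarrow> \<forall>x\<in>set xs. a \<le> x \<Longrightarrow> list_all2 (\<le>) (replicate m a) xs"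
  by (auto simp: list_all2_conv_all_nth)

text \<open>A zero entry is an isolated vertex, which separates unless it is the only vertex; a
  single vertex would need degree 4.\<close>

lemma forcibly_bicyclic_pos:
  assumes "forcibly_graphic bicyclic D"
  shows "\<forall>d\<in>set D. d \<ge> 1"
proof
  fix d assume "d \<in> set D"
  then obtain i where i: "i < length D" "D ! i = d" by (auto simp: in_set_conv_nth)
  from assms obtain E where er: "edge_realization D E"
    and ns: "\<not> separable D" and sum: "sum_list D = 2 * length D + 2"
    by (auto simp: forcibly_bicyclic_iff realizable_def)
  show "d \<ge> 1"
  proof (rule ccontr)
    assume "\<not> d \<ge> 1"
    then have "card (E `` {i}) = 0"
      using edge_realization_degree(2)[OF er i(1)] i(2) by simp
    then have "E `` {i} = {}"
      using edge_realization_degree(1)[OF er i(1)] by simp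
    moreover have "length D \<noteq> 1"
    proof
      assume "length D = 1"
      then obtain x where "D = [x]" by (auto simp: length_Suc_conv)
      then show False using sum degree_less_length[OF er, of 0] by simp
    qed
    then have "{i} \<subset> {..<length D}" using i(1)
      by (metis card_lessThan empty_subsetI insert_subset is_singletonI is_singleton_altdef lessThan_iff psubsetI)
    ultimately have "separates (length D) E {i}" by (auto simp: separates_def)
    with er ns show False by (auto simp: separable_def)
  qed
qed

section \<open>Sequences with at least two leaves\<close>

text \<open>No core graph with two more edges than vertices fits below the big entries.
  \<open>K4\<close> excludes \<open>b3 \<ge> 3\<close>, the other cores then restrict
  \<open>b2\<close>, \<open>b1\<close> and finally the number of twos.\<close>

lemma not_separable_two_leaves_cases:
  fixes b0 b1 b2 b3 p :: nat
  assumes p: "p \<ge> 2" and sorted: "sorted_wrt (\<ge>) (b0 # b1 # b2 # b3 # b)"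
    and ge2: "\<forall>d\<in>set (b0 # b1 # b2 # b3 # b). d \<ge> 2"
    and sum: "sum_list (b0 # b1 # b2 # b3 # b) = p + 2 * length b + 10"
    and ns: "\<not> separable ((b0 # b1 # b2 # b3 # b) @ replicate p 1)"
    and le: "b0 < p + length b + 4"
  shows "b = [] \<and> b1 \<ge> 3 \<and> b3 = 2 \<and> b0 + b1 + b2 = p + 8 \<or>
    b = [2] \<and> b0 = p + 4 \<and> b1 = 2 \<and> b2 = 2 \<and> b3 = 2 \<or>
    b = [2, 2] \<and> b0 = p + 4 \<and> b1 = 2 \<and> b2 = 2 \<and> b3 = 2 \<or>
    b = [2] \<and> b0 = p + 3 \<and> b1 = 3 \<and> b2 = 2 \<and> b3 = 2"
proof -
  let ?b = "b0 # b1 # b2 # b3 # b"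
  let ?m = "length b"
  \<comment> \<open>The sum \<open>2 * ?m + 12\<close> is twice the edge number
    \<open>(?m + 4) + 2\<close> of such a core.\<close>
  have T: "\<not> list_all2 (\<le>) c ?b" if "realizable c" "sum_list c = 2 * ?m + 12" "c \<noteq> []" for c
    using separable_attach_leaves[OF that(1) _ that(3), of ?b p] that(2) sum p ns by auto
  have two: "list_all2 (\<le>) (replicate n 2) xs" if "length xs = n" "set xs \<subseteq> set b" for n xs
    using that ge2 by (intro list_all2_replicate_le) auto
  have ord: "b0 \<ge> b1" "b1 \<ge> b2" "b2 \<ge> b3" "\<forall>x\<in>set b. x \<le> b3" "b3 \<ge> 2" "\<forall>x\<in>set b. x \<ge> 2"
    using sorted ge2 by auto
  have K4: "\<not> b3 \<ge> 3"
    using T[OF realizable_K4_twos, of ?m] ord two[of b ?m] by (auto simp: sum_list_replicate)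
  then have b3: "b3 = 2" using ord by simp
  then have b: "b = replicate ?m 2" using ord by (metis le_antisym replicate_eqI)
  show ?thesis
  proof (cases b)
    case Nil
    with b3 sum have "b0 + b1 + b2 = p + 8" by simp
    \<comment> \<open>Since \<open>b0 < p + 4\<close>, the entries \<open>b1\<close> and
      \<open>b2\<close> add up to more than 4.\<close>
    moreover from this Nil have "b1 \<ge> 3" using le ord b3 by simp
    ultimately show ?thesis using Nil b3 by simp
  next
    case (Cons x b')
    define m where "m = length b'"
    have b: "b = 2 # replicate m 2" using b Cons by (simp add: m_def)
    have lb: "?m = Suc m" by (simp add: b)
    have rep: "list_all2 (\<le>) (replicate j 2) (replicate j (2 :: nat))" for j
      by (simp add: list_all2_replicate_le)
    have s: "b0 + b1 + b2 = p + 8" using sum b3 by (simp add: b sum_list_replicate)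
    have "\<not> (b0 \<ge> 4 \<and> b1 \<ge> 3 \<and> b2 \<ge> 3)"
      using T[OF realizable_4_3_3_twos, of m] ord rep b3 by (auto simp: sum_list_replicate b)
    \<comment> \<open>If \<open>b2 \<ge> 3\<close>, then \<open>b0 \<le> 3\<close>, so the three
      entries would add up to at most 9, whereas \<open>p + 8 \<ge> 10\<close>.\<close>
    then have b2: "b2 = 2" using s ord b3 p by linarith
    have "\<not> (b0 \<ge> 4 \<and> b1 \<ge> 4)"
      using T[OF realizable_4_4_twos, of m] ord rep b3 b2 by (auto simp: sum_list_replicate b)
    then have b1: "b1 \<le> 3" using s ord by linarith
    show ?thesis
    proof (cases "b1 = 3")
      case True
      \<comment> \<open>Now \<open>b0 = p + 3 \<ge> 5\<close>, so a sixth big vertex would make room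
        for the core with degrees 5 and 3.\<close>
      have "m = 0"
      proof (rule ccontr)
        assume "m \<noteq> 0"
        then obtain j where "m = Suc j" by (cases m) auto
        then show False using T[OF realizable_5_3_twos, of j] rep b3 b2 True s p
          by (auto simp: sum_list_replicate b)
      qed
      then show ?thesis using True s b2 b3 b by simp
    next
      case False
      then have b1: "b1 = 2" using b1 ord b2 by simp
      \<comment> \<open>Now \<open>b0 = p + 4 \<ge> 6\<close>, so a seventh big vertex would make
        room for three triangles sharing a vertex.\<close>
      have "m < 2"
      proof (rule ccontr)
        assume "\<not> m < 2"
        then obtain j where "m = Suc (Suc j)" by (metis add_2_eq_Suc le_Suc_ex not_less)
        then show False using T[OF realizable_6_twos, of j] rep b3 b2 b1 s p
          by (auto simp: sum_list_replicate b)
      qed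
      then have "m = 0 \<or> m = 1" by arith
      then show ?thesis using b1 s b2 b3 b by auto
    qed
  qed
qed

section \<open>Sequences with at most one leaf\<close>

text \<open>Three twos are split off as a triangle. The rest needs a core with one more edge than
  vertices: \<open>K4\<close> minus an edge, or two triangles sharing a vertex.\<close>

lemma not_separable_one_leaf_cases:
  fixes b0 b1 b2 b3 p :: nat
  assumes p: "p < 2" and sorted: "sorted_wrt (\<ge>) (b0 # b1 # b2 # b3 # b)"
    and ge2: "\<forall>d\<in>set (b0 # b1 # b2 # b3 # b). d \<ge> 2"
    and sum: "sum_list (b0 # b1 # b2 # b3 # b) = p + 2 * length b + 10"
    and ns: "\<not> separable ((b0 # b1 # b2 # b3 # b) @ replicate p 1)"
    and le: "b0 < p + length b + 4"
  shows "b3 = 2 \<and> b = replicate (length b) 2 \<and> b0 + b1 + b2 = p + 8 \<and>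
    (b1 \<ge> 3 \<and> length b \<le> 2 \<or> b0 = p + 4 \<and> b1 = 2 \<and> b2 = 2 \<and> 1 \<le> length b \<and> length b \<le> 3)"
proof -
  let ?m = "length b"
  have ord: "b0 \<ge> b1" "b1 \<ge> b2" "b2 \<ge> b3" "\<forall>x\<in>set b. x \<le> b3" "b3 \<ge> 2" "\<forall>x\<in>set b. x \<ge> 2"
    using sorted ge2 by auto
  have "list_all2 (\<le>) (replicate ?m 2) b" using ord by (intro list_all2_replicate_le) auto
  then have "2 * ?m \<le> sum_list b"
    using sum_list_mono2[of "replicate ?m 2" b] by (auto simp: list_all2_conv_all_nth sum_list_replicate)
  \<comment> \<open>If \<open>b3 \<ge> 3\<close>, the first four entries would add up to at least
    12, but they add up to at most \<open>p + 10 \<le> 11\<close>.\<close>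
  then have b3: "b3 = 2" using sum ord p by simp
  then have b: "b = replicate ?m 2" using ord by (metis le_antisym replicate_eqI)
  then have "sum_list b = sum_list (replicate ?m 2)" by (rule arg_cong)
  also have "\<dots> = 2 * ?m" by (simp add: sum_list_replicate)
  finally have "sum_list b = 2 * ?m" .
  then have s: "b0 + b1 + b2 = p + 8" using sum b3 by simp
  have rep: "list_all2 (\<le>) (replicate j 2) (replicate j (2 :: nat))" for j
    by (simp add: list_all2_replicate_le)
  have D: "(b0 # b1 # b2 # replicate j 2) @ [2, 2, 2] @ replicate p 1 =
      (b0 # b1 # b2 # b3 # b) @ replicate p 1" if "?m = j + 2" for j
  proof -
    have "replicate j 2 @ [2, 2, 2] = replicate j 2 @ replicate 3 (2 :: nat)"
      by (simp add: numeral_3_eq_3)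
    also have "\<dots> = replicate (j + 3) 2" by (simp only: replicate_add)
    also have "\<dots> = b3 # b" using b b3 that by (metis add_Suc_right eval_nat_numeral(3) replicate_Suc)
    finally show ?thesis by simp
  qed
  have T: "\<not> list_all2 (\<le>) c (b0 # b1 # b2 # replicate j 2)"
    if "?m = j + 2" "realizable c" "sum_list c = 2 * j + 8" "c \<noteq> []" for c j
    using separable_triangle_attach_leaves[OF that(2) _ that(4), of "b0 # b1 # b2 # replicate j 2" p]
      ns s that(3) unfolding D[OF that(1)] by (auto simp: sum_list_replicate)
  show ?thesis
  proof (cases "b1 \<ge> 3")
    case True
    have "?m \<le> 2"
    proof (rule ccontr)
      assume "\<not> ?m \<le> 2"
      \<comment> \<open>The four vertices of the core and the three of the triangle fit as soon as
        there are 7 big entries, that is, \<open>?m \<ge> 3\<close>.\<close>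
      then have "?m = Suc (?m - 3) + 2" by simp
      then obtain j where "?m = Suc j + 2" ..
      from T[OF this realizable_diamond_twos[of j]] True ord rep show False
        by (auto simp: sum_list_replicate)
    qed
    with True show ?thesis using b b3 s by simp
  next
    case False
    then have b12: "b1 = 2" "b2 = 2" "b0 = p + 4" using ord s by auto
    have "?m \<le> 3"
    proof (rule ccontr)
      assume "\<not> ?m \<le> 3"
      \<comment> \<open>Here the core has five vertices, so 8 big entries suffice, that is,
        \<open>?m \<ge> 4\<close>.\<close>
      then have "?m = Suc (Suc (?m - 4)) + 2" by simp
      then obtain j where "?m = Suc (Suc j) + 2" ..
      from T[OF this realizable_4_twos[of j]] b12 rep show False
        by (auto simp: sum_list_replicate)
    qed
    moreover have "1 \<le> ?m" using le b12(3) by linarith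
    ultimately show ?thesis using b b3 s b12 by simp
  qed
qed

section \<open>The two directions of the classification\<close>

lemma forcibly_bicyclicI:
  assumes "realizable c" "list_all2 (\<le>) c b" "sum_list b = sum_list c + p"
    "sum_list b = p + 2 * length b + 2" "\<not> separable (b @ replicate p 1)"
  shows "forcibly_graphic bicyclic (b @ replicate p 1)"
  using realizable_attach_leaves[OF assms(1-3)] assms(4,5)
  by (simp add: forcibly_bicyclic_iff sum_list_replicate)

theorem theorem4p1:
  fixes D :: "nat list" and n :: nat
  assumes "length D = n" and "sorted_wrt (\<ge>) D"
  shows "forcibly_graphic bicyclic D \<longleftrightarrow>
      (D = replicate 2 3 @ replicate 4 2 \<or>
       D = replicate 3 3 @ replicate 2 2 @ [1] \<or>
       D = replicate 3 3 @ replicate 3 2 @ [1] \<or>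
       D = [4] @ replicate 6 2 \<or>
       D = [4, 3] @ replicate 4 2 @ [1] \<or>
       D = [5] @ replicate 6 2 @ [1])
    \<or> (n \<ge> 5 \<and> D = [n - 1] @ replicate 4 2 @ replicate (n - 5) 1)
    \<or> (n \<ge> 6 \<and> D = [n - 2] @ replicate 5 2 @ replicate (n - 6) 1)
    \<or> (n \<ge> 5 \<and> D = [n - 2, 3] @ replicate 3 2 @ replicate (n - 5) 1)
    \<or> (n \<ge> 4 \<and> (\<exists>r s t. r \<ge> s \<and> s \<ge> 3 \<and> t \<ge> 2 \<and> r + s + t = n + 4 \<and>
         D = [r, s, t, 2] @ replicate (n - 4) 1))"
proof (rule iffI, goal_cases)
  case 1
  then have r: "realizable D" and ns: "\<not> separable D" and sum: "sum_list D = 2 * n + 2"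
    using assms(1) by (auto simp: forcibly_bicyclic_iff)
  obtain b p where b: "D = b @ replicate p 1" "sorted_wrt (\<ge>) b" "\<forall>d\<in>set b. d \<ge> 2"
    using sorted_pos_split_ones[OF assms(2) forcibly_bicyclic_pos[OF 1]] by blast
  have sumb: "sum_list b = p + 2 * length b + 2"
    using sum assms(1) by (simp add: b(1) sum_list_replicate)
  have "length b \<ge> 4" using length_big_ge_4 r sumb unfolding b(1) by blast
  then obtain b0 b1 b2 b3 b' where bs: "b = b0 # b1 # b2 # b3 # b'"
    by (auto simp: numeral_eq_Suc Suc_le_length_iff)
  have n: "n = p + length b' + 4" using assms(1) by (simp add: b(1) bs)
  obtain E where "edge_realization D E" using r by (auto simp: realizable_def)
  from degree_less_length[OF this, of 0] have le: "b0 < p + length b' + 4"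
    by (simp add: b(1) bs)
  have sumb': "sum_list (b0 # b1 # b2 # b3 # b') = p + 2 * length b' + 10"
    using sumb unfolding bs by simp
  note args = b(2,3)[unfolded bs] sumb' ns[unfolded b(1) bs] le
  have ord: "b0 \<ge> b1" "b1 \<ge> b2" "b2 \<ge> 2" using args(1,2) by auto
  have four_big: "n \<ge> 4 \<and> (\<exists>r s t. r \<ge> s \<and> s \<ge> 3 \<and> t \<ge> 2 \<and> r + s + t = n + 4 \<and>
         D = [r, s, t, 2] @ replicate (n - 4) 1)"
    if "b' = []" "b1 \<ge> 3" "b3 = 2" "b0 + b1 + b2 = p + 8"
    using that ord n by (auto simp: b(1) bs)
  show ?case
  proof (cases "p \<ge> 2")
    case True
    from not_separable_two_leaves_cases[OF True args] show ?thesis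
    proof (elim disjE conjE, goal_cases)
      case 1
      with four_big show ?case by blast
    qed (simp_all add: b(1) bs n numeral_eq_Suc)
  next
    case False
    then have p: "p = 0 \<or> p = 1" by arith
    from False have "p < 2" by simp
    note c = not_separable_one_leaf_cases[OF this args]
    then consider (A) "b1 \<ge> 3" "length b' \<le> 2" | (B) "b0 = p + 4" "b1 = 2" "b2 = 2" "1 \<le> length b'" "length b' \<le> 3"
      by blast
    then show ?thesis
    proof cases
      case A
      then have len: "length b' = 0 \<or> length b' = 1 \<or> length b' = 2" by arith
      have vals: "p = 0 \<and> b0 = 3 \<and> b1 = 3 \<and> b2 = 2 \<or> p = 1 \<and> b0 = 4 \<and> b1 = 3 \<and> b2 = 2 \<or>
          p = 1 \<and> b0 = 3 \<and> b1 = 3 \<and> b2 = 3"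
      proof -
        have s: "b0 + b1 + b2 = p + 8" using c by blast
        \<comment> \<open>\<open>b1 \<ge> 4\<close> would give \<open>b0 + b1 + b2 \<ge> 10\<close>,
          but \<open>p + 8 \<le> 9\<close>.\<close>
        then have b1: "b1 = 3" using A(1) ord p by linarith
        then have "b2 = 2 \<or> b2 = 3" using ord by arith
        then show ?thesis using s b1 ord(1) p by auto
      qed
      have b': "b' = replicate (length b') 2" "b3 = 2" using c by auto
      show ?thesis
      proof (cases "b' = []")
        case True
        then show ?thesis using four_big c A by blast
      next
        case False
        with len have "length b' = 1 \<or> length b' = 2" by auto
        with b'(1) have "b' = [2] \<or> b' = [2, 2]" by (auto simp: numeral_eq_Suc)
        \<comment> \<open>With \<open>b' = [2]\<close> and \<open>b2 = 2\<close> the list has the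
          form \<open>(n - 2, 3, 2, 2, 2, ...)\<close>; the other four lists are sporadic.\<close>
        then show ?thesis using vals b'(2) n
          by (elim disjE conjE) (simp_all add: b(1) bs numeral_eq_Suc)
      qed
    next
      case B
      then have "length b' = 1 \<or> length b' = 2 \<or> length b' = 3" by arith
      moreover have "b' = replicate (length b') 2" "b3 = 2" using c by auto
      ultimately have "b' = [2] \<or> b' = [2, 2] \<or> b' = [2, 2, 2]" "b3 = 2"
        by (auto simp: numeral_eq_Suc)
      \<comment> \<open>Since \<open>b0 = p + 4\<close>, one or two entries in \<open>b'\<close>
        give the families with largest entry \<open>n - 1\<close> and \<open>n - 2\<close>; three
        entries give the sporadic lists with six twos.\<close>
      then show ?thesis using B p n
        by (elim disjE conjE) (simp_all add: b(1) bs numeral_eq_Suc)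
    qed
  qed
next
  case 2
  have two: "realizable [3, 3, 2, 2]" "realizable [3, 3, 2, 2, 2]" "realizable [3, 3, 2, 2, 2, 2]"
    using realizable_diamond_twos[of 0] realizable_diamond_twos[of 1] realizable_diamond_twos[of 2]
    by (simp_all add: numeral_2_eq_2)
  have one: "realizable [4, 2, 2, 2, 2]" "realizable [4, 2, 2, 2, 2, 2]" "realizable [4, 2, 2, 2, 2, 2, 2]"
    using realizable_4_twos[of 0] realizable_4_twos[of 1] realizable_4_twos[of 2]
    by (simp_all add: numeral_2_eq_2)
  have S: "forcibly_graphic bicyclic ([3, 3, 2, 2, 2, 2] @ replicate 0 1)"
    "forcibly_graphic bicyclic ([3, 3, 3, 2, 2] @ replicate 1 1)"
    "forcibly_graphic bicyclic ([3, 3, 3, 2, 2, 2] @ replicate 1 1)"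
    "forcibly_graphic bicyclic ([4, 2, 2, 2, 2, 2, 2] @ replicate 0 1)"
    "forcibly_graphic bicyclic ([4, 3, 2, 2, 2, 2] @ replicate 1 1)"
    "forcibly_graphic bicyclic ([5, 2, 2, 2, 2, 2, 2] @ replicate 1 1)"
    subgoal by (intro forcibly_bicyclicI[OF two(3)] not_separable_one_leaf) simp_all
    subgoal by (intro forcibly_bicyclicI[OF two(2)] not_separable_one_leaf) simp_all
    \<comment> \<open>The largest entry 3 is too small for the general criterion on seven
      vertices.\<close>
    subgoal using not_separable_3332221 by (intro forcibly_bicyclicI[OF two(3)]) auto
    subgoal by (intro forcibly_bicyclicI[OF one(3)] not_separable_one_leaf) simp_all
    subgoal by (intro forcibly_bicyclicI[OF two(3)] not_separable_one_leaf) simp_all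
    subgoal by (intro forcibly_bicyclicI[OF one(3)] not_separable_one_leaf) simp_all
    done
  \<comment> \<open>With the number \<open>p\<close> of leaves as parameter, the largest entry is
    visibly the length minus 1 or 2, as \<open>not_separable_max_degree\<close> requires.\<close>
  have max2: "forcibly_graphic bicyclic ([p + 4, 2, 2, 2, 2] @ replicate p 1)"
    "forcibly_graphic bicyclic ([p + 4, 2, 2, 2, 2, 2] @ replicate p 1)"
    "forcibly_graphic bicyclic ([p + 3, 3, 2, 2, 2] @ replicate p 1)" for p
    subgoal by (intro forcibly_bicyclicI[OF one(1)] not_separable_max_degree) auto
    subgoal by (intro forcibly_bicyclicI[OF one(2)] not_separable_max_degree) auto
    subgoal by (intro forcibly_bicyclicI[OF two(2)] not_separable_max_degree) auto
    done
  have four: "forcibly_graphic bicyclic ([r, s, t, 2] @ replicate (n - 4) 1)"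
    if "n \<ge> 4" "r \<ge> s" "s \<ge> 3" "t \<ge> 2" "r + s + t = n + 4" for r s t
    using that not_separable_four_big[of r s t "n - 4"] by (intro forcibly_bicyclicI[OF two(1)]) auto
  have ones: "replicate 2 (3::nat) @ replicate 4 2 = [3, 3, 2, 2, 2, 2] @ replicate 0 1"
    "replicate 3 (3::nat) @ replicate 2 2 @ [1] = [3, 3, 3, 2, 2] @ replicate 1 1"
    "replicate 3 (3::nat) @ replicate 3 2 @ [1] = [3, 3, 3, 2, 2, 2] @ replicate 1 1"
    "[4::nat] @ replicate 6 2 = [4, 2, 2, 2, 2, 2, 2] @ replicate 0 1"
    "[4::nat, 3] @ replicate 4 2 @ [1] = [4, 3, 2, 2, 2, 2] @ replicate 1 1"
    "[5::nat] @ replicate 6 2 @ [1] = [5, 2, 2, 2, 2, 2, 2] @ replicate 1 1"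
    by (simp_all add: numeral_eq_Suc)
  have tail: "[n - 1] @ replicate 4 2 @ replicate (n - 5) 1 = [n - 5 + 4, 2, 2, 2, 2] @ replicate (n - 5) 1"
    "[n - 2, 3] @ replicate 3 2 @ replicate (n - 5) 1 = [n - 5 + 3, 3, 2, 2, 2] @ replicate (n - 5) 1"
    if "n \<ge> 5"
    using that by (simp_all add: numeral_eq_Suc)
  have tail6: "[n - 2] @ replicate 5 2 @ replicate (n - 6) 1 = [n - 6 + 4, 2, 2, 2, 2, 2] @ replicate (n - 6) 1"
    if "n \<ge> 6"
    using that by (simp add: numeral_eq_Suc)
  from 2 show ?case
    unfolding ones using S max2 tail tail6 four by (elim disjE conjE exE) metis+
qed

end
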